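(* Let $\mu$ be a positive Radon measure with a support inside a ball $B(0,R_0)\subset\mathbb{R}^2$. Assume that there exists a positive constant $c_1$ such that for any radius $r<R_0$ $$\mu(B(0,r))=c_1 r^{\alpha},\quad\text{where }\alpha>0.$$ Then $\mu\in H^{-1}(\mathbb{R}^2)$.
   Context: $B(x,r)$ denotes the ball in $\mathbb{R}^2$ with center $x$ and radius $r$. A tempered distribution $f$ on $\mathbb{R}^2$ belongs to $H^{-1}(\mathbb{R}^2)$ if $\|f\|_{H^{-1}(\mathbb{R}^2)}^2:=\int_{\mathbb{R}^2}(1+|\xi|^2)^{-1}|\hat f(\xi)|^2\,d\xi<\infty$, where $\hat f$ denotes the Fourier transform of $f$. A compactly supported Radon measure is identified with the tempered distribution it defines. *)

theory Defs
  imports "HOL-Analysis.Analysis"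
begin

definition radon_measure :: "(real ^ 'n::finite) measure \<Rightarrow> bool" where
  "radon_measure \<mu> \<longleftrightarrow>
     sets \<mu> = sets borel \<and>
     (\<forall>K. compact K \<longrightarrow> emeasure \<mu> K < \<infinity>) \<and>
     (\<forall>B\<in>sets borel. emeasure \<mu> B = (SUP K\<in>{K. compact K \<and> K \<subseteq> B}. emeasure \<mu> K))"

text \<open>
  A measure sits inside a set when it does not charge the complement. For open \<open>A\<close> this is
  weaker than requiring the (closed) topological support to be a subset of \<open>A\<close>; the latter
  would be incompatible with mass \<open>c * r powr \<alpha>\<close> of all balls of radius \<open>r < R\<close> when
  \<open>A = ball 0 R\<close>, since such a measure has the whole mass in a strictly smaller ball.
\<close>

definition supported_in :: "(real ^ 'n::finite) measure \<Rightarrow> (real ^ 'n) set \<Rightarrow> bool" where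
  "supported_in \<mu> A \<longleftrightarrow> emeasure \<mu> (- A) = 0"

definition partial_deriv :: "'n \<Rightarrow> (real ^ 'n::finite \<Rightarrow> complex) \<Rightarrow> (real ^ 'n \<Rightarrow> complex)" where
  "partial_deriv i f = (\<lambda>x. frechet_derivative f (at x) (axis i 1))"

text \<open>
  Multi-indices are encoded as lists of coordinates. A function is infinitely differentiable iff
  all its iterated partial derivatives exist and are differentiable everywhere (this includes
  their continuity).
\<close>

definition iter_partial :: "'n list \<Rightarrow> (real ^ 'n::finite \<Rightarrow> complex) \<Rightarrow> (real ^ 'n \<Rightarrow> complex)" where
  "iter_partial is f = foldr partial_deriv is f"

definition smooth :: "(real ^ 'n::finite \<Rightarrow> complex) \<Rightarrow> bool" where
  "smooth f \<longleftrightarrow> (\<forall>is. iter_partial is f differentiable_on UNIV)"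

definition schwartz_space :: "(real ^ 'n::finite \<Rightarrow> complex) set" where
  "schwartz_space = {f. smooth f \<and>
     (\<forall>k is. bdd_above (range (\<lambda>x. (1 + norm x) ^ k * norm (iter_partial is f x))))}"

definition schwartz_seminorm :: "nat \<Rightarrow> 'n list \<Rightarrow> (real ^ 'n::finite \<Rightarrow> complex) \<Rightarrow> real" where
  "schwartz_seminorm k is f = (SUP x. (1 + norm x) ^ k * norm (iter_partial is f x))"

definition schwartz_tendsto ::
  "(nat \<Rightarrow> real ^ 'n::finite \<Rightarrow> complex) \<Rightarrow> (real ^ 'n \<Rightarrow> complex) \<Rightarrow> bool" where
  "schwartz_tendsto \<phi> \<psi> \<longleftrightarrow>
     (\<forall>k is. (\<lambda>j. schwartz_seminorm k is (\<lambda>x. \<phi> j x - \<psi> x)) \<longlonglongrightarrow> 0)"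

text \<open>
  Distributions are total functionals of which only the values on the Schwartz space matter.
  The Schwartz space is metrizable, so continuity is sequential continuity.
\<close>

type_synonym 'n functional = "(real ^ 'n \<Rightarrow> complex) \<Rightarrow> complex"

definition tempered_distribution :: "'n::finite functional \<Rightarrow> bool" where
  "tempered_distribution T \<longleftrightarrow>
     (\<forall>\<phi>\<in>schwartz_space. \<forall>\<psi>\<in>schwartz_space. T (\<lambda>x. \<phi> x + \<psi> x) = T \<phi> + T \<psi>) \<and>
     (\<forall>\<phi>\<in>schwartz_space. \<forall>c. T (\<lambda>x. c * \<phi> x) = c * T \<phi>) \<and>
     (\<forall>\<phi> \<psi>. (\<forall>j. \<phi> j \<in> schwartz_space) \<and> \<psi> \<in> schwartz_space \<and> schwartz_tendsto \<phi> \<psi> \<longrightarrow>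
        (\<lambda>j. T (\<phi> j)) \<longlonglongrightarrow> T \<psi>)"

definition fourier_fun :: "(real ^ 'n::finite \<Rightarrow> complex) \<Rightarrow> (real ^ 'n \<Rightarrow> complex)" where
  "fourier_fun \<phi> = (\<lambda>\<xi>. \<integral>x. exp (- \<i> * complex_of_real (x \<bullet> \<xi>)) * \<phi> x \<partial>lborel)"

definition fourier_distr :: "'n::finite functional \<Rightarrow> 'n functional" where
  "fourier_distr T = (\<lambda>\<phi>. T (fourier_fun \<phi>))"

definition represented_by :: "'n::finite functional \<Rightarrow> (real ^ 'n \<Rightarrow> complex) \<Rightarrow> bool" where
  "represented_by T g \<longleftrightarrow> g \<in> borel_measurable borel \<and>
     (\<forall>\<phi>\<in>schwartz_space. integrable lborel (\<lambda>x. g x * \<phi> x) \<and> T \<phi> = (\<integral>x. g x * \<phi> x \<partial>lborel))"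

text \<open>
  Finiteness of the norm does not depend on the normalisation of the Fourier transform. The
  integrability demanded by \<open>represented_by\<close> follows from finiteness of the weighted integral.
\<close>

definition H_minus1 :: "'n::finite functional set" where
  "H_minus1 = {T. tempered_distribution T \<and>
     (\<exists>g. represented_by (fourier_distr T) g \<and>
        (\<integral>\<^sup>+\<xi>. ennreal (inverse (1 + (norm \<xi>)\<^sup>2) * (norm (g \<xi>))\<^sup>2) \<partial>lborel) < \<infinity>)}"

definition measure_distr :: "(real ^ 'n::finite) measure \<Rightarrow> 'n functional" where
  "measure_distr \<mu> = (\<lambda>\<phi>. \<integral>x. \<phi> x \<partial>\<mu>)"

end

theory Submission
  imports Defs "HOL-Probability.Characteristic_Functions" "HOL-Probability.Sinc_Integral"
    "HOL-Real_Asymp.Real_Asymp"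
begin

text \<open>
  Let \<open>g\<close> be the Fourier transform of \<open>\<mu>\<close>, a bounded function representing the distributional
  transform by Fubini. The weight \<open>1 / (1 + |\<xi>|\<^sup>2)\<close> is dominated by a constant times
  \<open>\<Sum>k. t\<^sub>k exp (- t\<^sub>k |\<xi>|\<^sup>2)\<close> with \<open>t\<^sub>k = 16^-k\<close>, and in the plane
  \<open>\<integral> t exp (- t |\<xi>|\<^sup>2) |g|\<^sup>2 = \<pi> \<integral>\<integral> exp (- |x - y|\<^sup>2 / (4 t)) d\<mu>(x) d\<mu>(y)\<close>.
  Only the radial distribution of \<open>\<mu>\<close> is known, but it suffices: since \<open>|x - y| \<ge> ||x| - |y||\<close>,
  the pairs with \<open>|x - y| < \<delta>\<close> are controlled by the mass of annuli of width \<open>2 \<delta>\<close>, which is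
  \<open>O(\<delta> powr min \<alpha> 1)\<close> because \<open>r powr \<alpha>\<close> is Hoelder continuous. With \<open>\<delta> = 2^-k\<close>,
  so that \<open>t\<^sub>k = \<delta>^4\<close>, the energies are bounded by a convergent geometric series.
\<close>

section \<open>Gaussian integrals\<close>

text \<open>\<open>lborel\<close> on a Euclidean space is the image of the product of
  one-dimensional Lebesgue measures under the coordinate map, so both claims reduce to Fubini for
  finite products.\<close>

lemma
  fixes f :: "'a::euclidean_space \<Rightarrow> real \<Rightarrow> 'b::{real_normed_field,banach,second_countable_topology}"
  assumes f: "\<And>b. b \<in> Basis \<Longrightarrow> integrable lborel (f b)"
  shows integrable_lborel_prod: "integrable lborel (\<lambda>x. \<Prod>b\<in>Basis. f b (x \<bullet> b))"
    and integral_lborel_prod: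
      "(\<integral>x. (\<Prod>b\<in>Basis. f b (x \<bullet> b)) \<partial>lborel) = (\<Prod>b\<in>Basis. integral\<^sup>L lborel (f b))"
proof -
  interpret product_sigma_finite "\<lambda>_::'a. lborel :: real measure" ..
  have [measurable]: "f b \<in> borel_measurable borel" if "b \<in> Basis" for b
    using borel_measurable_integrable[OF f[OF that]] by simp
  have m: "(\<lambda>x. \<Prod>b\<in>Basis. f b (x \<bullet> b)) \<in> borel_measurable borel"
    by (intro borel_measurable_prod) measurable
  have s: "(\<lambda>f. \<Sum>b\<in>Basis. f b *\<^sub>R b) \<in> (\<Pi>\<^sub>M b\<in>(Basis::'a set). lborel) \<rightarrow>\<^sub>M borel"
    by measurable
  have eq: "(\<Prod>b\<in>Basis. f b ((\<Sum>c\<in>Basis. u c *\<^sub>R c) \<bullet> b)) = (\<Prod>b\<in>Basis. f b (u b))" for u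
    by (intro prod.cong) auto
  show "integrable lborel (\<lambda>x. \<Prod>b\<in>Basis. f b (x \<bullet> b))"
    using product_integrable_prod[OF finite_Basis f]
    by (subst lborel_eq) (simp add: integrable_distr_eq[OF s m] eq)
  show "(\<integral>x. (\<Prod>b\<in>Basis. f b (x \<bullet> b)) \<partial>lborel) = (\<Prod>b\<in>Basis. integral\<^sup>L lborel (f b))"
    using product_integral_prod[OF finite_Basis f]
    by (subst lborel_eq) (simp add: integral_distr[OF s m] eq)
qed

text \<open>The substitution v = c * u with c = sqrt (2 * t) turns exp (- t * u^2) into exp (- v^2 /
  2). What remains is, up to constants, the characteristic function of the standard normal
  distribution at - a / c, which is known.\<close>

lemma
  fixes t a :: real
  assumes "t > 0"
  shows integrable_gaussian_exp:
      "integrable lborel (\<lambda>u. complex_of_real (exp (- (t * u\<^sup>2))) * exp (- \<i> * complex_of_real (u * a)))"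
    and integral_gaussian_exp:
      "(\<integral>u. complex_of_real (exp (- (t * u\<^sup>2))) * exp (- \<i> * complex_of_real (u * a)) \<partial>lborel)
         = complex_of_real (sqrt (pi / t) * exp (- a\<^sup>2 / (4 * t)))"
proof -
  define c where "c = sqrt (2 * t)"
  have c: "c > 0" "c\<^sup>2 = 2 * t" using assms by (auto simp: c_def)
  define h where "h u = std_normal_density u *\<^sub>R iexp (- (a / c) * u)" for u
  have hint: "integrable lborel h"
    unfolding h_def
    by (rule Bochner_Integration.integrable_bound[of _ std_normal_density])
       (auto simp: integrable_normal_density)
  have "char std_normal_distribution (- (a / c)) = (\<integral>u. h u \<partial>lborel)"
    unfolding char_def h_def by (subst integral_density) (auto simp: scaleR_conv_of_real)
  then have hval: "(\<integral>u. h u \<partial>lborel) = complex_of_real (exp (- (a / c)\<^sup>2 / 2))"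
    by (simp add: char_std_normal_distribution)
  \<comment> \<open>The argument is written \<open>0 + c * u\<close> to match the form of the affine
    substitution rules for \<open>lborel\<close>.\<close>
  have eq: "complex_of_real (exp (- (t * u\<^sup>2))) * exp (- \<i> * complex_of_real (u * a))
      = complex_of_real (sqrt (2 * pi)) * h (0 + c * u)" for u
    using c by (simp add: h_def normal_density_def scaleR_conv_of_real power_mult_distrib mult_ac)
  show "integrable lborel (\<lambda>u. complex_of_real (exp (- (t * u\<^sup>2))) * exp (- \<i> * complex_of_real (u * a)))"
    unfolding eq using lborel_integrable_real_affine[OF hint, of c 0] c by auto
  have "(\<integral>u. h (0 + c * u) \<partial>lborel) = complex_of_real (exp (- (a / c)\<^sup>2 / 2) / c)"
    using lborel_integral_real_affine[of c h 0] c hval by (simp add: scaleR_conv_of_real field_simps)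
  moreover have "sqrt (2 * pi) * (exp (- (a / c)\<^sup>2 / 2) / c) = sqrt (pi / t) * exp (- a\<^sup>2 / (4 * t))"
    using c assms by (simp add: power_divide) (simp add: c_def real_sqrt_mult real_sqrt_divide)
  ultimately show "(\<integral>u. complex_of_real (exp (- (t * u\<^sup>2))) * exp (- \<i> * complex_of_real (u * a)) \<partial>lborel)
         = complex_of_real (sqrt (pi / t) * exp (- a\<^sup>2 / (4 * t)))"
    unfolding eq by (simp only: integral_mult_right_zero of_real_mult[symmetric])
qed

text \<open>Both the squared norm and the inner product are sums over coordinates, so the integrand
  factors into one-dimensional Gaussians.\<close>

lemma
  fixes z :: "'a::euclidean_space" and t :: real
  assumes "t > 0"
  shows integrable_gaussian_exp_euclidean:
      "integrable lborel (\<lambda>\<xi>::'a. complex_of_real (exp (- (t * (norm \<xi>)\<^sup>2))) * exp (- \<i> * complex_of_real (\<xi> \<bullet> z)))"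
    and integral_gaussian_exp_euclidean:
      "(\<integral>\<xi>. complex_of_real (exp (- (t * (norm \<xi>)\<^sup>2))) * exp (- \<i> * complex_of_real (\<xi> \<bullet> z)) \<partial>lborel)
         = complex_of_real (sqrt (pi / t) ^ DIM('a) * exp (- (norm z)\<^sup>2 / (4 * t)))"
proof -
  have n2: "(norm x)\<^sup>2 = (\<Sum>b\<in>Basis. (x \<bullet> b)\<^sup>2)" for x :: 'a
    using euclidean_inner[of x x] by (simp add: dot_square_norm power2_eq_square)
  have eq: "complex_of_real (exp (- (t * (norm \<xi>)\<^sup>2))) * exp (- \<i> * complex_of_real (\<xi> \<bullet> z))
     = (\<Prod>b\<in>Basis. complex_of_real (exp (- (t * (\<xi> \<bullet> b)\<^sup>2))) * exp (- \<i> * complex_of_real ((\<xi> \<bullet> b) * (z \<bullet> b))))" for \<xi> :: 'a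
    by (simp add: n2 euclidean_inner[of \<xi> z] prod.distrib exp_sum[symmetric] sum_distrib_left
        sum_negf[symmetric] of_real_prod[symmetric] del: of_real_mult)
  show "integrable lborel (\<lambda>\<xi>::'a. complex_of_real (exp (- (t * (norm \<xi>)\<^sup>2))) * exp (- \<i> * complex_of_real (\<xi> \<bullet> z)))"
    unfolding eq by (intro integrable_lborel_prod integrable_gaussian_exp assms)
  have "(\<Prod>b\<in>Basis. sqrt (pi / t) * exp (- (z \<bullet> b)\<^sup>2 / (4 * t))) = sqrt (pi / t) ^ DIM('a) * exp (- (norm z)\<^sup>2 / (4 * t))"
    by (simp add: prod.distrib exp_sum[symmetric] n2 sum_divide_distrib sum_negf[symmetric])
  then show "(\<integral>\<xi>. complex_of_real (exp (- (t * (norm \<xi>)\<^sup>2))) * exp (- \<i> * complex_of_real (\<xi> \<bullet> z)) \<partial>lborel)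
         = complex_of_real (sqrt (pi / t) ^ DIM('a) * exp (- (norm z)\<^sup>2 / (4 * t)))"
    unfolding eq
    by (subst integral_lborel_prod)
      (auto intro!: integrable_gaussian_exp assms simp only: integral_gaussian_exp[OF assms] of_real_prod[symmetric])
qed

section \<open>Finite measures as tempered distributions\<close>

lemma continuous_on_schwartz: "\<phi> \<in> schwartz_space \<Longrightarrow> continuous_on UNIV \<phi>"
  unfolding schwartz_space_def smooth_def iter_partial_def
  by (drule CollectD) (metis differentiable_imp_continuous_on foldr.simps(1) id_apply)

lemma borel_measurable_schwartz: "\<phi> \<in> schwartz_space \<Longrightarrow> \<phi> \<in> borel_measurable borel"
  by (intro borel_measurable_continuous_onI continuous_on_schwartz)

lemma schwartz_space_bound:
  assumes "\<phi> \<in> schwartz_space"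
  obtains C where "\<And>x. (1 + norm x) ^ k * norm (\<phi> x) \<le> C"
proof -
  have "bdd_above (range (\<lambda>x. (1 + norm x) ^ k * norm (iter_partial [] \<phi> x)))"
    using assms by (simp add: schwartz_space_def)
  then show ?thesis using that by (auto simp: bdd_above_def iter_partial_def)
qed

lemma lborel_integrable_inverse_1_plus_square: "integrable lborel (\<lambda>x::real. inverse (1 + x\<^sup>2))"
  using integrable_inverse_1_plus_square by (simp add: set_integrable_def)

text \<open>Each factor 1 + (x \<bullet> b)^2 is at most (1 + |x|)^2. Decay of order twice the
  dimension therefore dominates \<phi> by a constant times a product of functions 1 / (1 + u^2),
  each integrable on the line.\<close>

lemma integrable_schwartz:
  fixes \<phi> :: "real ^ 'n::finite \<Rightarrow> complex"
  assumes "\<phi> \<in> schwartz_space"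
  shows "integrable lborel \<phi>"
proof -
  obtain C where C: "\<And>x. (1 + norm x) ^ (2 * DIM(real ^ 'n)) * norm (\<phi> x) \<le> C"
    using schwartz_space_bound[OF assms] by blast
  have "integrable lborel (\<lambda>x::real ^ 'n. C * (\<Prod>b\<in>Basis. inverse (1 + (x \<bullet> b)\<^sup>2)))"
    by (intro integrable_mult_right integrable_lborel_prod lborel_integrable_inverse_1_plus_square)
  then show ?thesis
  proof (rule Bochner_Integration.integrable_bound)
    show "\<phi> \<in> borel_measurable lborel" using borel_measurable_schwartz[OF assms] by simp
    show "AE x in lborel. norm (\<phi> x) \<le> norm (C * (\<Prod>b\<in>Basis. inverse (1 + (x \<bullet> b)\<^sup>2)))"
    proof (intro AE_I2)
      fix x :: "real ^ 'n"
      have "1 + (x \<bullet> b)\<^sup>2 \<le> (1 + norm x)\<^sup>2" if "b \<in> Basis" for b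
      proof -
        have "(x \<bullet> b)\<^sup>2 \<le> (norm x)\<^sup>2"
          using Basis_le_norm[OF that, of x] by (metis abs_le_square_iff abs_norm_cancel)
        then show ?thesis by (simp add: power2_sum add_increasing2)
      qed
      then have "(\<Prod>b\<in>Basis. 1 + (x \<bullet> b)\<^sup>2) \<le> (\<Prod>b\<in>(Basis :: (real ^ 'n) set). (1 + norm x)\<^sup>2)"
        by (intro prod_mono) (auto simp: add_nonneg_nonneg)
      also have "\<dots> = (1 + norm x) ^ (2 * DIM(real ^ 'n))"
        by (simp add: power_mult)
      finally have "(\<Prod>b\<in>Basis. 1 + (x \<bullet> b)\<^sup>2) * norm (\<phi> x) \<le> C"
        using C[of x] by (meson mult_right_mono norm_ge_zero order_trans)
      moreover have "(\<Prod>b\<in>Basis. 1 + (x \<bullet> b)\<^sup>2) > 0"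
        by (intro prod_pos) (auto intro: add_pos_nonneg)
      ultimately have "norm (\<phi> x) \<le> C * inverse (\<Prod>b\<in>Basis. 1 + (x \<bullet> b)\<^sup>2)"
        by (simp add: field_simps)
      also have "\<dots> = C * (\<Prod>b\<in>Basis. inverse (1 + (x \<bullet> b)\<^sup>2))"
        by (simp add: prod_inversef[symmetric] comp_def)
      finally show "norm (\<phi> x) \<le> norm (C * (\<Prod>b\<in>Basis. inverse (1 + (x \<bullet> b)\<^sup>2)))"
        by simp
    qed
  qed
qed

lemma integrable_schwartz_finite_measure:
  fixes \<mu> :: "(real ^ 'n::finite) measure"
  assumes "finite_measure \<mu>" and sets: "sets \<mu> = sets borel" and "\<phi> \<in> schwartz_space"
  shows "integrable \<mu> \<phi>"
proof -
  interpret finite_measure \<mu> by fact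
  obtain C where "\<And>x. (1 + norm x) ^ 0 * norm (\<phi> x) \<le> C"
    using schwartz_space_bound[OF assms(3)] by blast
  then show ?thesis
    using borel_measurable_schwartz[OF assms(3)]
    by (intro integrable_const_bound[of _ C]) (simp_all add: measurable_cong_sets[OF sets refl])
qed

text \<open>Convergence in the zeroth seminorm is uniform convergence, which passes to integrals
  against a finite measure.\<close>

lemma tempered_distribution_measure_distr:
  fixes \<mu> :: "(real ^ 'n::finite) measure"
  assumes fin: "finite_measure \<mu>" and sets: "sets \<mu> = sets borel"
  shows "tempered_distribution (measure_distr \<mu>)"
  unfolding tempered_distribution_def
proof (intro conjI ballI allI impI)
  interpret finite_measure \<mu> by fact
  note int = integrable_schwartz_finite_measure[OF fin sets]
  fix \<phi> \<psi> :: "real ^ 'n \<Rightarrow> complex" assume "\<phi> \<in> schwartz_space" "\<psi> \<in> schwartz_space"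
  then show "measure_distr \<mu> (\<lambda>x. \<phi> x + \<psi> x) = measure_distr \<mu> \<phi> + measure_distr \<mu> \<psi>"
    by (simp add: measure_distr_def int)
next
  fix \<phi> :: "real ^ 'n \<Rightarrow> complex" and c
  show "measure_distr \<mu> (\<lambda>x. c * \<phi> x) = c * measure_distr \<mu> \<phi>"
    by (simp add: measure_distr_def)
next
  interpret finite_measure \<mu> by fact
  note int = integrable_schwartz_finite_measure[OF fin sets]
  fix \<phi> :: "nat \<Rightarrow> real ^ 'n \<Rightarrow> complex" and \<psi> :: "real ^ 'n \<Rightarrow> complex"
  assume "(\<forall>j. \<phi> j \<in> schwartz_space) \<and> \<psi> \<in> schwartz_space \<and> schwartz_tendsto \<phi> \<psi>"
  then have \<phi>: "\<And>j. \<phi> j \<in> schwartz_space" and \<psi>: "\<psi> \<in> schwartz_space"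
    and conv: "schwartz_tendsto \<phi> \<psi>" by auto
  define D where "D j = schwartz_seminorm 0 [] (\<lambda>x. \<phi> j x - \<psi> x)" for j
  have D: "D \<longlonglongrightarrow> 0"
    using conv unfolding schwartz_tendsto_def D_def by blast
  \<comment> \<open>The seminorm is a real supremum, so it bounds its members only once the range is
    known to be bounded above; the bounds of the two functions provide this.\<close>
  have le: "norm (\<phi> j x - \<psi> x) \<le> D j" for j x
  proof -
    obtain A where A: "\<And>x. (1 + norm x) ^ 0 * norm (\<phi> j x) \<le> A"
      using schwartz_space_bound[OF \<phi>] by blast
    obtain B where B: "\<And>x. (1 + norm x) ^ 0 * norm (\<psi> x) \<le> B"
      using schwartz_space_bound[OF \<psi>] by blast
    have "norm (\<phi> j x - \<psi> x) \<le> A + B" for x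
      using norm_triangle_ineq4[of "\<phi> j x" "\<psi> x"] A[of x] B[of x] by simp
    then have "bdd_above (range (\<lambda>x. norm (\<phi> j x - \<psi> x)))"
      by (auto simp: bdd_above_def)
    then show ?thesis
      unfolding D_def schwartz_seminorm_def iter_partial_def
      by (auto intro: cSUP_upper)
  qed
  have "norm (measure_distr \<mu> (\<phi> j) - measure_distr \<mu> \<psi>) \<le> D j * measure \<mu> (space \<mu>)" for j
  proof -
    have "norm (measure_distr \<mu> (\<phi> j) - measure_distr \<mu> \<psi>) = norm (\<integral>x. \<phi> j x - \<psi> x \<partial>\<mu>)"
      by (simp add: measure_distr_def int \<phi> \<psi>)
    also have "\<dots> \<le> (\<integral>x. D j \<partial>\<mu>)"
      using le by (intro order_trans[OF integral_norm_bound] integral_mono)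
        (simp_all add: int \<phi> \<psi>)
    finally show ?thesis by (simp add: mult.commute)
  qed
  then have "(\<lambda>j. measure_distr \<mu> (\<phi> j) - measure_distr \<mu> \<psi>) \<longlonglongrightarrow> 0"
    by (intro Lim_null_comparison[OF _ tendsto_mult_left_zero[OF D]] always_eventually allI)
  then show "(\<lambda>j. measure_distr \<mu> (\<phi> j)) \<longlonglongrightarrow> measure_distr \<mu> \<psi>"
    by (simp add: LIM_zero_iff)
qed

section \<open>The Fourier transform of a finite measure as a function\<close>

text \<open>Sign and normalisation agree with \<open>fourier_fun\<close>, so this function
  represents the distributional transform without a correcting constant.\<close>

definition fourier_measure :: "'a::euclidean_space measure \<Rightarrow> 'a \<Rightarrow> complex" where
  "fourier_measure \<mu> \<xi> = (\<integral>x. exp (- \<i> * complex_of_real (x \<bullet> \<xi>)) \<partial>\<mu>)"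

lemma borel_measurable_fourier_measure:
  fixes \<mu> :: "'a::euclidean_space measure"
  assumes "finite_measure \<mu>" and [measurable_cong, simp]: "sets \<mu> = sets borel"
  shows "fourier_measure \<mu> \<in> borel_measurable borel"
proof -
  interpret finite_measure \<mu> by fact
  show ?thesis unfolding fourier_measure_def by measurable
qed

lemma norm_fourier_measure_le:
  fixes \<mu> :: "'a::euclidean_space measure"
  assumes "finite_measure \<mu>"
  shows "norm (fourier_measure \<mu> \<xi>) \<le> measure \<mu> (space \<mu>)"
proof -
  have "norm (fourier_measure \<mu> \<xi>) \<le> (\<integral>x. norm (exp (- \<i> * complex_of_real (x \<bullet> \<xi>))) \<partial>\<mu>)"
    unfolding fourier_measure_def by (rule integral_norm_bound)
  then show ?thesis by simp
qed

text \<open>Testing the transform against \<phi> integrates \<open>fourier_fun \<phi>\<close> over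
  \<mu>; Fubini moves the exponential from \<phi> to \<mu>. It applies because the exponential has
  modulus 1, \<phi> is integrable and \<mu> is finite.\<close>

lemma represented_by_fourier_measure:
  fixes \<mu> :: "(real ^ 'n::finite) measure"
  assumes fin: "finite_measure \<mu>" and [measurable_cong, simp]: "sets \<mu> = sets borel"
  shows "represented_by (fourier_distr (measure_distr \<mu>)) (fourier_measure \<mu>)"
  unfolding represented_by_def
proof (intro conjI ballI borel_measurable_fourier_measure assms)
  interpret finite_measure \<mu> by fact
  interpret P: pair_sigma_finite \<mu> lborel ..
  fix \<phi> :: "real ^ 'n \<Rightarrow> complex" assume \<phi>: "\<phi> \<in> schwartz_space"
  note [measurable] = borel_measurable_schwartz[OF \<phi>] borel_measurable_fourier_measure[OF assms]
  note int = integrable_schwartz[OF \<phi>]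
  show "integrable lborel (\<lambda>x. fourier_measure \<mu> x * \<phi> x)"
    using norm_fourier_measure_le[OF fin]
    by (intro Bochner_Integration.integrable_bound[OF integrable_mult_right[OF int, of "measure \<mu> (space \<mu>)"]])
       (auto simp: norm_mult intro!: mult_right_mono)
  let ?f = "\<lambda>x \<xi>. exp (- \<i> * complex_of_real (\<xi> \<bullet> x)) * \<phi> \<xi>"
  have "integrable (\<mu> \<Otimes>\<^sub>M lborel) (case_prod ?f)"
  proof (rule P.Fubini_integrable)
    show "integrable \<mu> (\<lambda>x. \<integral>\<xi>. norm (case_prod ?f (x, \<xi>)) \<partial>lborel)"
      by (simp add: norm_mult)
    show "AE x in \<mu>. integrable lborel (\<lambda>\<xi>. case_prod ?f (x, \<xi>))"
      by (auto intro!: Bochner_Integration.integrable_bound[OF int] simp: norm_mult)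
  qed simp
  from P.Fubini_integral[OF this]
  show "fourier_distr (measure_distr \<mu>) \<phi> = (\<integral>x. fourier_measure \<mu> x * \<phi> x \<partial>lborel)"
    by (simp add: fourier_distr_def measure_distr_def fourier_fun_def fourier_measure_def inner_commute)
qed

section \<open>Gaussian energies\<close>

lemma integrable_gaussian_pair:
  fixes \<mu> :: "'a::euclidean_space measure"
  assumes fin: "finite_measure \<mu>" and [measurable_cong, simp]: "sets \<mu> = sets borel" and "t > 0"
  shows "integrable (\<mu> \<Otimes>\<^sub>M \<mu>) (\<lambda>(x, y). exp (- (norm (x - y))\<^sup>2 / (4 * t)))"
proof -
  interpret finite_measure \<mu> by fact
  interpret P: finite_measure "\<mu> \<Otimes>\<^sub>M \<mu>"
    by (intro finite_measure_pair_measure fin)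
  show ?thesis using \<open>t > 0\<close>
    by (intro P.integrable_const_bound[of _ 1]) (auto simp: case_prod_unfold)
qed

text \<open>The squared modulus of the transform is the double integral of the exponential at x - y.
  Exchanging it with the integral over \<xi> leaves the Fourier transform of a Gaussian at x -
  y.\<close>

lemma nn_integral_gaussian_fourier_measure:
  fixes \<mu> :: "'a::euclidean_space measure"
  assumes fin: "finite_measure \<mu>" and [measurable_cong, simp]: "sets \<mu> = sets borel" and "t > 0"
  shows "(\<integral>\<^sup>+\<xi>. ennreal (exp (- (t * (norm \<xi>)\<^sup>2)) * (norm (fourier_measure \<mu> \<xi>))\<^sup>2) \<partial>lborel)
    = ennreal (sqrt (pi / t) ^ DIM('a) *
        (\<integral>(x, y). exp (- (norm (x - y))\<^sup>2 / (4 * t)) \<partial>(\<mu> \<Otimes>\<^sub>M \<mu>)))"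
proof -
  interpret finite_measure \<mu> by fact
  interpret Q: finite_measure "\<mu> \<Otimes>\<^sub>M \<mu>"
    by (intro finite_measure_pair_measure fin)
  interpret MM: pair_sigma_finite \<mu> \<mu> ..
  interpret P: pair_sigma_finite "\<mu> \<Otimes>\<^sub>M \<mu>" "lborel :: 'a measure" ..
  note [measurable] = borel_measurable_fourier_measure[OF assms(1,2)]
  let ?G = "\<lambda>\<xi>::'a. exp (- (t * (norm \<xi>)\<^sup>2))"
  let ?e = "\<lambda>x \<xi>::'a. exp (- \<i> * complex_of_real (x \<bullet> \<xi>))"
  let ?f = "\<lambda>(x, y) \<xi>. complex_of_real (?G \<xi>) * ?e (x - y) \<xi>"
  have Gint: "integrable lborel (\<lambda>\<xi>. complex_of_real (?G \<xi>))"
    using integrable_gaussian_exp_euclidean[OF \<open>t > 0\<close>, of "0::'a"] by simp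
  have sq: "complex_of_real ((norm (fourier_measure \<mu> \<xi>))\<^sup>2) = (\<integral>p. ?e (fst p - snd p) \<xi> \<partial>(\<mu> \<Otimes>\<^sub>M \<mu>))" for \<xi>
  proof -
    have split: "?e (x - y) \<xi> = ?e x \<xi> * cnj (?e y \<xi>)" for x y
      by (simp add: exp_cnj exp_add[symmetric] inner_diff_left algebra_simps)
    have "integrable (\<mu> \<Otimes>\<^sub>M \<mu>) (\<lambda>(x, y). ?e (x - y) \<xi>)"
      by (auto intro!: Q.integrable_const_bound[of _ 1] simp: case_prod_unfold)
    from MM.integral_fst[OF this]
    have "(\<integral>p. ?e (fst p - snd p) \<xi> \<partial>(\<mu> \<Otimes>\<^sub>M \<mu>)) = (\<integral>x. (\<integral>y. ?e (x - y) \<xi> \<partial>\<mu>) \<partial>\<mu>)"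
      by (simp add: case_prod_unfold)
    also have "\<dots> = fourier_measure \<mu> \<xi> * cnj (fourier_measure \<mu> \<xi>)"
      unfolding split fourier_measure_def
      by (simp only: integral_mult_right_zero integral_mult_left_zero Bochner_Integration.integral_cnj)
    finally show ?thesis by (simp only: complex_norm_square)
  qed
  \<comment> \<open>The modulus of the integrand is the Gaussian in \<xi>, independent of the pair
    (x, y), and the product measure is finite.\<close>
  have fint: "integrable ((\<mu> \<Otimes>\<^sub>M \<mu>) \<Otimes>\<^sub>M lborel) (case_prod ?f)"
  proof (rule P.Fubini_integrable)
    show "integrable (\<mu> \<Otimes>\<^sub>M \<mu>) (\<lambda>x. \<integral>\<xi>. norm (case_prod ?f (x, \<xi>)) \<partial>lborel)"
      by (simp add: norm_mult case_prod_unfold)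
    show "AE x in \<mu> \<Otimes>\<^sub>M \<mu>. integrable lborel (\<lambda>\<xi>. case_prod ?f (x, \<xi>))"
      by (auto intro!: Bochner_Integration.integrable_bound[OF Gint] simp: norm_mult case_prod_unfold)
  qed (simp add: case_prod_unfold)
  have "complex_of_real (\<integral>\<xi>. ?G \<xi> * (norm (fourier_measure \<mu> \<xi>))\<^sup>2 \<partial>lborel)
      = (\<integral>\<xi>. (\<integral>p. ?f p \<xi> \<partial>(\<mu> \<Otimes>\<^sub>M \<mu>)) \<partial>lborel)"
    by (simp only: integral_complex_of_real[symmetric] of_real_mult sq case_prod_unfold integral_mult_right_zero)
  also have "\<dots> = (\<integral>p. (\<integral>\<xi>. ?f p \<xi> \<partial>lborel) \<partial>(\<mu> \<Otimes>\<^sub>M \<mu>))"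
    by (rule P.Fubini_integral[OF fint])
  also have "\<dots> = (\<integral>p. complex_of_real (sqrt (pi / t) ^ DIM('a) * exp (- (norm (fst p - snd p))\<^sup>2 / (4 * t))) \<partial>(\<mu> \<Otimes>\<^sub>M \<mu>))"
    using integral_gaussian_exp_euclidean[OF \<open>t > 0\<close>, where 'a = 'a]
    by (intro Bochner_Integration.integral_cong refl)
      (simp only: case_prod_unfold inner_commute[of "a - b" for a b])
  also have "\<dots> = complex_of_real (sqrt (pi / t) ^ DIM('a) * (\<integral>p. exp (- (norm (fst p - snd p))\<^sup>2 / (4 * t)) \<partial>(\<mu> \<Otimes>\<^sub>M \<mu>)))"
    by (simp only: integral_complex_of_real integral_mult_right_zero)
  finally have eq: "(\<integral>\<xi>. ?G \<xi> * (norm (fourier_measure \<mu> \<xi>))\<^sup>2 \<partial>lborel)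
      = sqrt (pi / t) ^ DIM('a) * (\<integral>(x, y). exp (- (norm (x - y))\<^sup>2 / (4 * t)) \<partial>(\<mu> \<Otimes>\<^sub>M \<mu>))"
    by (simp only: of_real_eq_iff case_prod_unfold)
  \<comment> \<open>A Bochner integral defaults to 0 on non-integrable functions, so passing to the
    nonnegative integral requires integrability as well as the value \<open>eq\<close>.\<close>
  have "integrable lborel (\<lambda>\<xi>. ?G \<xi> * (norm (fourier_measure \<mu> \<xi>))\<^sup>2)"
  proof (rule Bochner_Integration.integrable_bound)
    show "integrable lborel (\<lambda>\<xi>. complex_of_real (?G \<xi>) * complex_of_real ((measure \<mu> (space \<mu>))\<^sup>2))"
      by (rule integrable_mult_left[OF Gint])
    show "AE \<xi> in lborel. norm (?G \<xi> * (norm (fourier_measure \<mu> \<xi>))\<^sup>2)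
        \<le> norm (complex_of_real (?G \<xi>) * complex_of_real ((measure \<mu> (space \<mu>))\<^sup>2))"
      using norm_fourier_measure_le[OF fin] by (auto simp: norm_mult norm_power intro!: power_mono)
  qed simp
  then show ?thesis
    by (subst nn_integral_eq_integral) (auto simp: eq)
qed

section \<open>Comparison of the Sobolev weight with a sum of Gaussians\<close>

lemma member_le_suminf:
  fixes f :: "nat \<Rightarrow> ennreal"
  shows "f k \<le> (\<Sum>i. f i)"
  using sum_le_suminf[of f "{k}"] by (simp add: summableI)

text \<open>One term of the series suffices. Choose k with 16^k \<le> 1 + s < 16^(k+1) and t =
  16^-k: the lower bound gives 1 / (1 + s) \<le> t, and the upper bound gives t * s \<le> 16, so exp
  16 compensates for the exponential factor.\<close>

lemma inverse_1_plus_le_suminf_exp: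
  assumes "s \<ge> 0"
  shows "ennreal (inverse (1 + s)) \<le> (\<Sum>k. ennreal (exp 16 * ((1 / 16) ^ k * exp (- ((1 / 16) ^ k * s)))))"
proof -
  define n where "n = (LEAST n. 1 + s < 16 ^ n)"
  have n: "1 + s < 16 ^ n"
    unfolding n_def using real_arch_pow[of 16 "1 + s"] by (auto intro: LeastI)
  \<comment> \<open>The case n = 0 is impossible, as it would mean 1 + s < 1.\<close>
  then obtain k where k: "n = Suc k"
    using assms by (cases n) auto
  have lower: "16 ^ k \<le> 1 + s"
    using not_less_Least[of k "\<lambda>n. 1 + s < 16 ^ n"] k unfolding n_def[symmetric] by simp
  define t :: real where "t = (1 / 16) ^ k"
  have t: "t > 0" "t * 16 ^ k = 1" by (simp_all add: t_def power_divide)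
  have "t * s \<le> t * 16 ^ n" using n t(1) by (intro mult_left_mono) auto
  also have "\<dots> = 16" using t k by simp
  finally have ts: "1 \<le> exp (16 - t * s)" by simp
  have "1 \<le> t * (1 + s)" using mult_left_mono[OF lower, of t] t by simp
  then have "inverse (1 + s) \<le> t" using assms by (simp add: field_simps)
  also have "t \<le> t * exp (16 - t * s)" using ts t by simp
  also have "\<dots> = exp 16 * (t * exp (- (t * s)))" by (simp add: exp_diff exp_minus field_simps)
  finally have "ennreal (inverse (1 + s)) \<le> ennreal (exp 16 * ((1 / 16) ^ k * exp (- ((1 / 16) ^ k * s))))"
    by (simp add: t_def ennreal_leI)
  also have "\<dots> \<le> (\<Sum>k. ennreal (exp 16 * ((1 / 16) ^ k * exp (- ((1 / 16) ^ k * s)))))"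
    by (rule member_le_suminf)
  finally show ?thesis .
qed

section \<open>Hoelder continuity of powers and the mass of annuli\<close>

text \<open>For \<alpha> \<le> 1 the power is subadditive, so K = 1 works. For \<alpha> > 1 the mean
  value theorem bounds the difference quotient by the derivative at R.\<close>

lemma powr_diff_le_holder:
  fixes \<alpha> R :: real
  assumes "\<alpha> > 0" "R > 0"
  obtains K where "K \<ge> 0"
    and "\<And>a b. \<lbrakk>0 \<le> a; a \<le> b; b \<le> R\<rbrakk> \<Longrightarrow> b powr \<alpha> - a powr \<alpha> \<le> K * (b - a) powr min \<alpha> 1"
proof (cases "\<alpha> \<le> 1")
  case True
  have le: "x \<le> x powr \<alpha>" if "0 \<le> x" "x \<le> 1" for x :: real
    using powr_mono'[of \<alpha> 1 x] that True by (cases "x = 0") auto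
  have "b powr \<alpha> - a powr \<alpha> \<le> 1 * (b - a) powr min \<alpha> 1" if "0 \<le> a" "a \<le> b" for a b :: real
  proof (cases "b = 0")
    case False
    then have b: "b > 0" using that by simp
    \<comment> \<open>Subadditivity after scaling by b: the two fractions lie in [0, 1], where
      raising to the power \<alpha> \<le> 1 does not decrease a number.\<close>
    have "1 = a / b + (b - a) / b" using b by (simp add: field_simps)
    also have "\<dots> \<le> (a / b) powr \<alpha> + ((b - a) / b) powr \<alpha>"
      using that b by (intro add_mono le) auto
    also have "\<dots> = (a powr \<alpha> + (b - a) powr \<alpha>) / b powr \<alpha>"
      using that b by (simp add: powr_divide add_divide_distrib)
    finally have "b powr \<alpha> \<le> a powr \<alpha> + (b - a) powr \<alpha>"
      using b by (simp add: field_simps)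
    then show ?thesis using True by (simp add: min_def)
  qed (use that in auto)
  then show ?thesis using that[of 1] by simp
next
  case False
  have "b powr \<alpha> - a powr \<alpha> \<le> \<alpha> * R powr (\<alpha> - 1) * (b - a) powr min \<alpha> 1"
    if ab: "0 \<le> a" "a \<le> b" "b \<le> R" for a b :: real
  proof (cases "a = b")
    case ne: False
    with ab have "a < b" by simp
    \<comment> \<open>Since a = 0 is allowed, the derivative is taken only to the right of a; the
      mean value theorem needs it only in the open interval.\<close>
    have der: "((\<lambda>x. x powr \<alpha>) has_real_derivative \<alpha> * x powr (\<alpha> - 1)) (at x)" if "a < x" for x
      using that ab by (auto intro!: derivative_eq_intros has_real_derivative_powr)
    have "continuous_on {a..b} (\<lambda>x. x powr \<alpha>)"
      using ab assms by (intro continuous_on_powr' continuous_intros) auto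
    moreover have "(\<lambda>x. x powr \<alpha>) differentiable at x" if "a < x" for x
      using der[OF that] real_differentiable_def by blast
    ultimately obtain l z where "a < z" "z < b" "DERIV (\<lambda>x. x powr \<alpha>) z :> l"
      "b powr \<alpha> - a powr \<alpha> = (b - a) * l"
      using MVT[OF \<open>a < b\<close>, of "\<lambda>x. x powr \<alpha>"] by auto
    then have z: "a < z" "z < b" "b powr \<alpha> - a powr \<alpha> = (b - a) * (\<alpha> * z powr (\<alpha> - 1))"
      using DERIV_unique[OF _ der[of z]] by auto
    have "z powr (\<alpha> - 1) \<le> R powr (\<alpha> - 1)"
      using z ab False by (intro powr_mono2) auto
    then show ?thesis using z(3) ab False \<open>a < b\<close>
      by (simp add: min_def mult_ac mult_left_mono)
  qed (use assms in auto)
  then show ?thesis using that[of "\<alpha> * R powr (\<alpha> - 1)"] assms by simp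
qed

text \<open>The annulus lies in a difference of concentric balls with radii 2 * \<delta> apart.
  Clamping radii to [0, R] is monotone and does not increase distances, so the Hoelder bound applies
  to the clamped radii for every real s.\<close>

lemma measure_annulus_le:
  fixes \<mu> :: "'a::euclidean_space measure"
  assumes "finite_measure \<mu>" and sets: "sets \<mu> = sets borel"
    and "\<alpha> > 0" "R > 0" "c \<ge> 0"
    and ball: "\<And>r. measure \<mu> (ball 0 r) = c * max 0 (min r R) powr \<alpha>"
  obtains K where "K \<ge> 0"
    and "\<And>s \<delta>. \<delta> > 0 \<Longrightarrow> measure \<mu> {x. \<bar>norm x - s\<bar> < \<delta>} \<le> K * \<delta> powr min \<alpha> 1"
proof -
  interpret finite_measure \<mu> by fact
  obtain K where K: "K \<ge> 0"
    "\<And>a b. \<lbrakk>0 \<le> a; a \<le> b; b \<le> R\<rbrakk> \<Longrightarrow> b powr \<alpha> - a powr \<alpha> \<le> K * (b - a) powr min \<alpha> 1"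
    using powr_diff_le_holder[OF assms(3,4)] by blast
  have "measure \<mu> {x. \<bar>norm x - s\<bar> < \<delta>} \<le> c * K * 2 powr min \<alpha> 1 * \<delta> powr min \<alpha> 1"
    if "\<delta> > 0" for s \<delta>
  proof -
    let ?h = "\<lambda>r. max 0 (min r R)"
    have "measure \<mu> {x. \<bar>norm x - s\<bar> < \<delta>} \<le> measure \<mu> (ball 0 (s + \<delta>) - ball 0 (s - \<delta>))"
      by (rule finite_measure_mono) (auto simp: sets)
    also have "\<dots> = measure \<mu> (ball 0 (s + \<delta>)) - measure \<mu> (ball 0 (s - \<delta>))"
      using that by (intro finite_measure_Diff) (auto simp: sets)
    also have "\<dots> = c * (?h (s + \<delta>) powr \<alpha> - ?h (s - \<delta>) powr \<alpha>)"
      by (simp add: ball right_diff_distrib)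
    also have "\<dots> \<le> c * (K * (?h (s + \<delta>) - ?h (s - \<delta>)) powr min \<alpha> 1)"
      using that assms by (intro mult_left_mono K) auto
    also have "\<dots> \<le> c * (K * (2 * \<delta>) powr min \<alpha> 1)"
      using that assms K(1) by (intro mult_left_mono powr_mono2) auto
    finally show ?thesis using that by (simp add: powr_mult mult_ac)
  qed
  then show ?thesis using that[of "c * K * 2 powr min \<alpha> 1"] K(1) \<open>c \<ge> 0\<close> by simp
qed

section \<open>Energy estimate and summation over scales\<close>

text \<open>Pairs closer than \<delta> have norms differing by less than \<delta>, so for fixed x
  they cost at most the mass of an annulus. For the other pairs the parameter \<delta>^4 makes the
  Gaussian at most 4 * \<delta>^2.\<close>

lemma gaussian_energy_le:
  fixes \<mu> :: "'a::euclidean_space measure"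
  assumes fin: "finite_measure \<mu>" and [measurable_cong, simp]: "sets \<mu> = sets borel"
    and "\<delta> > 0"
    and annulus: "\<And>s. measure \<mu> {x. \<bar>norm x - s\<bar> < \<delta>} \<le> A"
  shows "(\<integral>(x, y). exp (- (norm (x - y))\<^sup>2 / (4 * \<delta> ^ 4)) \<partial>(\<mu> \<Otimes>\<^sub>M \<mu>))
    \<le> measure \<mu> (space \<mu>) * (A + 4 * \<delta>\<^sup>2 * measure \<mu> (space \<mu>))"
proof -
  interpret finite_measure \<mu> by fact
  interpret MM: pair_sigma_finite \<mu> \<mu> ..
  let ?f = "\<lambda>x y::'a. exp (- (norm (x - y))\<^sup>2 / (4 * \<delta> ^ 4))"
  let ?S = "\<lambda>x::'a. {y. \<bar>norm y - norm x\<bar> < \<delta>}"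
  have int: "integrable (\<mu> \<Otimes>\<^sub>M \<mu>) (\<lambda>(x, y). ?f x y)"
    using \<open>\<delta> > 0\<close> by (intro integrable_gaussian_pair assms) auto
  have S: "?S x \<in> sets \<mu>" for x
    by simp
  have pt: "?f x y \<le> indicator (?S x) y + 4 * \<delta>\<^sup>2" for x y
  proof (cases "norm (x - y) < \<delta>")
    case True
    then have "y \<in> ?S x" using norm_triangle_ineq3[of y x] by (simp add: norm_minus_commute)
    moreover have "?f x y \<le> 1" by simp
    moreover have "0 \<le> 4 * \<delta>\<^sup>2" by simp
    ultimately show ?thesis by (simp add: add_increasing2)
  next
    case False
    \<comment> \<open>The exponent at distance exactly \<delta>, up to sign; exp (- v) \<le> 1 / v
      then follows from 1 + v \<le> exp v.\<close>
    define v where "v = 1 / (4 * \<delta>\<^sup>2)"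
    have v: "v > 0" using \<open>\<delta> > 0\<close> by (simp add: v_def)
    have "v = \<delta>\<^sup>2 / (4 * \<delta> ^ 4)" using \<open>\<delta> > 0\<close> by (simp add: v_def field_simps power2_eq_square power4_eq_xxxx)
    also have "\<dots> \<le> (norm (x - y))\<^sup>2 / (4 * \<delta> ^ 4)"
      using False \<open>\<delta> > 0\<close> by (intro divide_right_mono power_mono) auto
    finally have "?f x y \<le> exp (- v)" by simp
    also have "\<dots> \<le> inverse v"
      using exp_ge_add_one_self[of v] v unfolding exp_minus by (intro le_imp_inverse_le) linarith+
    also have "\<dots> = 4 * \<delta>\<^sup>2" by (simp add: v_def)
    finally show ?thesis by (simp add: add_increasing)
  qed
  have inner: "(\<integral>y. ?f x y \<partial>\<mu>) \<le> A + 4 * \<delta>\<^sup>2 * measure \<mu> (space \<mu>)" for x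
  proof -
    have "(\<integral>y. ?f x y \<partial>\<mu>) \<le> (\<integral>y. indicator (?S x) y + 4 * \<delta>\<^sup>2 \<partial>\<mu>)"
      using \<open>\<delta> > 0\<close> S
      by (intro integral_mono pt Bochner_Integration.integrable_add integrable_const_bound[of "?f x" 1])
        (auto simp: emeasure_eq_measure)
    also have "\<dots> = measure \<mu> (?S x) + 4 * \<delta>\<^sup>2 * measure \<mu> (space \<mu>)"
      using S by (subst Bochner_Integration.integral_add) (auto simp: emeasure_eq_measure)
    finally show ?thesis using annulus[of "norm x"] by simp
  qed
  have "(\<integral>(x, y). ?f x y \<partial>(\<mu> \<Otimes>\<^sub>M \<mu>)) = (\<integral>x. (\<integral>y. ?f x y \<partial>\<mu>) \<partial>\<mu>)"
    using MM.integral_fst[OF int] by simp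
  also have "\<dots> \<le> (\<integral>x. A + 4 * \<delta>\<^sup>2 * measure \<mu> (space \<mu>) \<partial>\<mu>)"
    using MM.integrable_fst[OF int] by (intro integral_mono inner) auto
  finally show ?thesis by simp
qed

text \<open>The weight is replaced by the Gaussian series and integrated termwise. At scale \<delta>
  = 2^-k the energy bound gives two geometric series, with ratios (1 / 2) powr \<gamma> and 1 /
  4.\<close>

lemma fourier_measure_weighted_L2:
  fixes \<mu> :: "'a::euclidean_space measure"
  assumes fin: "finite_measure \<mu>" and sets: "sets \<mu> = sets borel" and dim: "DIM('a) = 2"
    and "K \<ge> 0" "\<gamma> > 0"
    and annulus: "\<And>s \<delta>. \<delta> > 0 \<Longrightarrow> measure \<mu> {x. \<bar>norm x - s\<bar> < \<delta>} \<le> K * \<delta> powr \<gamma>"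
  shows "(\<integral>\<^sup>+\<xi>. ennreal (inverse (1 + (norm \<xi>)\<^sup>2) * (norm (fourier_measure \<mu> \<xi>))\<^sup>2) \<partial>lborel) < \<infinity>"
proof -
  note [measurable] = borel_measurable_fourier_measure[OF fin sets]
  define M where "M = measure \<mu> (space \<mu>)"
  define t :: "nat \<Rightarrow> real" where "t k = (1 / 16) ^ k" for k
  let ?g = "\<lambda>\<xi>. (norm (fourier_measure \<mu> \<xi>))\<^sup>2"
  let ?b = "\<lambda>k. exp 16 * pi * (M * (K * ((1 / 2) powr \<gamma>) ^ k + 4 * (1 / 4) ^ k * M))"
  have t: "t k > 0" for k by (simp add: t_def)
  have "(\<integral>\<^sup>+\<xi>. ennreal (inverse (1 + (norm \<xi>)\<^sup>2) * ?g \<xi>) \<partial>lborel)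
     \<le> (\<integral>\<^sup>+\<xi>. (\<Sum>k. ennreal (exp 16 * t k) * ennreal (exp (- (t k * (norm \<xi>)\<^sup>2)) * ?g \<xi>)) \<partial>lborel)"
  proof (rule nn_integral_mono)
    fix \<xi> :: 'a
    have "ennreal (inverse (1 + (norm \<xi>)\<^sup>2) * ?g \<xi>)
        \<le> (\<Sum>k. ennreal (exp 16 * (t k * exp (- (t k * (norm \<xi>)\<^sup>2))))) * ennreal (?g \<xi>)"
      unfolding t_def by (subst ennreal_mult) (auto intro!: mult_right_mono inverse_1_plus_le_suminf_exp)
    also have "\<dots> = (\<Sum>k. ennreal (exp 16 * t k) * ennreal (exp (- (t k * (norm \<xi>)\<^sup>2)) * ?g \<xi>))"
      unfolding ennreal_suminf_multc[symmetric] using t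
      by (intro suminf_cong) (simp add: ennreal_mult[symmetric] less_imp_le mult_ac)
    finally show "ennreal (inverse (1 + (norm \<xi>)\<^sup>2) * ?g \<xi>)
      \<le> (\<Sum>k. ennreal (exp 16 * t k) * ennreal (exp (- (t k * (norm \<xi>)\<^sup>2)) * ?g \<xi>))" .
  qed
  also have "\<dots> = (\<Sum>k. ennreal (exp 16 * t k) * (\<integral>\<^sup>+\<xi>. ennreal (exp (- (t k * (norm \<xi>)\<^sup>2)) * ?g \<xi>) \<partial>lborel))"
    by (simp add: nn_integral_suminf nn_integral_cmult)
  also have "\<dots> \<le> (\<Sum>k. ennreal (?b k))"
  proof (rule suminf_le)
    fix k
    let ?\<delta> = "(1 / 2) ^ k :: real"
    let ?E = "\<integral>(x, y). exp (- (norm (x - y))\<^sup>2 / (4 * t k)) \<partial>(\<mu> \<Otimes>\<^sub>M \<mu>)"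
    have t\<delta>: "t k = ?\<delta> ^ 4"
      by (simp add: t_def power_mult[symmetric] mult.commute[of k] power_divide) (simp add: power_mult)
    have E: "?E \<le> M * (K * ?\<delta> powr \<gamma> + 4 * ?\<delta>\<^sup>2 * M)"
      unfolding M_def t\<delta> by (intro gaussian_energy_le fin sets annulus) auto
    \<comment> \<open>Dimension two enters here: the Gaussian normalisation is exactly
      \<open>pi / t k\<close>, which cancels the coefficient \<open>t k\<close>.\<close>
    have "ennreal (exp 16 * t k) * (\<integral>\<^sup>+\<xi>. ennreal (exp (- (t k * (norm \<xi>)\<^sup>2)) * ?g \<xi>) \<partial>lborel)
      = ennreal (exp 16 * t k) * ennreal (pi / t k * ?E)"
      using t[of k] by (simp add: nn_integral_gaussian_fourier_measure[OF fin sets t] dim)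
    also have "\<dots> = ennreal (exp 16 * t k * (pi / t k * ?E))"
      using t[of k] by (intro ennreal_mult'[symmetric]) auto
    also have "\<dots> = ennreal (exp 16 * pi * ?E)"
      using t[of k] by (simp add: mult.assoc)
    also have "\<dots> \<le> ennreal (exp 16 * pi * (M * (K * ?\<delta> powr \<gamma> + 4 * ?\<delta>\<^sup>2 * M)))"
      by (intro ennreal_leI mult_left_mono E) auto
    also have "?\<delta> powr \<gamma> = ((1 / 2) powr \<gamma>) ^ k"
      by (simp add: powr_realpow[symmetric] powr_powr mult.commute)
    also have "?\<delta>\<^sup>2 = (1 / 4) ^ k"
      by (simp add: power_mult[symmetric] mult.commute[of k] power_divide) (simp add: power_mult)
    finally show "ennreal (exp 16 * t k) * (\<integral>\<^sup>+\<xi>. ennreal (exp (- (t k * (norm \<xi>)\<^sup>2)) * ?g \<xi>) \<partial>lborel)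
      \<le> ennreal (?b k)" .
  qed (auto intro: summableI)
  also have "\<dots> < \<infinity>"
  proof -
    have "(1 / 2) powr \<gamma> < (1::real)"
      using powr_less_mono2[of \<gamma> "1/2" 1] \<open>\<gamma> > 0\<close> by simp
    then have "summable ?b"
      by (intro summable_mult summable_add summable_mult2 summable_geometric) auto
    moreover have "?b k \<ge> 0" for k
      using \<open>K \<ge> 0\<close> by (simp add: M_def)
    ultimately show ?thesis
      by (subst suminf_ennreal2) auto
  qed
  finally show ?thesis .
qed

section \<open>The mass of every centred ball, and the conclusion\<close>

theorem theorem1p1:
  fixes \<mu> :: "(real ^ 2) measure" and R0 c1 \<alpha> :: real
  assumes "radon_measure \<mu>"
    and "R0 > 0"
    and "supported_in \<mu> (ball 0 R0)"
    and "c1 > 0"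
    and "\<alpha> > 0"
    and "\<And>r. 0 < r \<Longrightarrow> r < R0 \<Longrightarrow> emeasure \<mu> (ball 0 r) = ennreal (c1 * r powr \<alpha>)"
  shows "measure_distr \<mu> \<in> H_minus1"
proof -
  have sets: "sets \<mu> = sets borel" and space: "space \<mu> = UNIV"
    using assms(1) sets_eq_imp_space_eq[of \<mu> borel] by (auto simp: radon_measure_def)
  have null: "emeasure \<mu> (- ball 0 R0) = 0"
    using assms(3) by (simp add: supported_in_def)
  have mass_cball: "emeasure \<mu> (cball 0 R0) < \<infinity>"
    using assms(1) compact_cball unfolding radon_measure_def by blast
  \<comment> \<open>The space is covered by a compact ball, of finite mass by the Radon property,
    and the null complement of the open ball.\<close>
  have fin: "finite_measure \<mu>"
  proof
    have "emeasure \<mu> (space \<mu>) \<le> emeasure \<mu> (cball 0 R0) + emeasure \<mu> (- ball 0 R0)"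
      unfolding space by (rule order_trans[OF emeasure_mono emeasure_subadditive]) (auto simp: sets)
    also have "\<dots> < \<infinity>"
      using mass_cball by (simp add: null)
    finally show "emeasure \<mu> (space \<mu>) \<noteq> \<infinity>" by simp
  qed
  interpret finite_measure \<mu> by fact
  have small: "measure \<mu> (ball 0 r) = c1 * r powr \<alpha>" if "0 < r" "r < R0" for r
    using assms(6)[OF that] \<open>c1 > 0\<close> by (simp add: measure_def)
  \<comment> \<open>The hypothesis stops short of the radius R0; this value comes from continuity
    from below along increasing radii.\<close>
  have full: "measure \<mu> (ball 0 R0) = c1 * R0 powr \<alpha>"
  proof (rule LIMSEQ_unique)
    \<comment> \<open>The shift by 2 keeps the first radius positive, as the mass formula
      requires.\<close>
    define r where "r n = R0 - R0 / (real n + 2)" for n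
    have r: "0 < r n" "r n < R0" for n
      using \<open>R0 > 0\<close> by (auto simp: r_def field_simps intro!: add_pos_nonneg)
    have r_lim: "r \<longlonglongrightarrow> R0"
      unfolding r_def by real_asymp
    have r_mono: "r m \<le> r n" if "m \<le> n" for m n
      using that \<open>R0 > 0\<close> unfolding r_def by (intro diff_left_mono divide_left_mono) auto
    have "(\<Union>n. ball 0 (r n)) = (ball 0 R0 :: (real ^ 2) set)"
    proof (intro equalityI subsetI)
      fix x :: "real ^ 2" assume "x \<in> ball 0 R0"
      then have "\<forall>\<^sub>F n in sequentially. norm x < r n"
        by (intro order_tendstoD(1)[OF r_lim]) simp
      then show "x \<in> (\<Union>n. ball 0 (r n))"
        by (auto simp: eventually_sequentially)
    qed (use r(2) in \<open>auto intro: less_trans\<close>)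
    moreover have "(\<lambda>n. measure \<mu> (ball 0 (r n))) \<longlonglongrightarrow> measure \<mu> (\<Union>n. ball 0 (r n))"
      using r_mono by (intro finite_Lim_measure_incseq) (auto simp: sets incseq_def intro: less_le_trans[OF _ r_mono])
    ultimately show "(\<lambda>n. measure \<mu> (ball 0 (r n))) \<longlonglongrightarrow> measure \<mu> (ball 0 R0)"
      by simp
    show "(\<lambda>n. measure \<mu> (ball 0 (r n))) \<longlonglongrightarrow> c1 * R0 powr \<alpha>"
      using r \<open>R0 > 0\<close> by (auto simp: small intro!: tendsto_intros r_lim)
  qed
  \<comment> \<open>Clamping covers all real radii: balls with r \<le> 0 are empty and
    \<open>0 powr \<alpha> = 0\<close>, while beyond R0 no mass is added.\<close>
  have ball: "measure \<mu> (ball 0 r) = c1 * max 0 (min r R0) powr \<alpha>" for r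
  proof -
    consider "r \<le> 0" | "0 < r" "r < R0" | "R0 \<le> r" by linarith
    then show ?thesis
    proof cases
      case 3
      have "measure \<mu> (ball 0 r) \<le> measure \<mu> (ball 0 R0 \<union> - ball 0 R0)"
        by (intro finite_measure_mono) (auto simp: sets)
      also have "\<dots> \<le> measure \<mu> (ball 0 R0) + measure \<mu> (- ball 0 R0)"
        by (intro measure_Un_le) (auto simp: sets)
      also have "measure \<mu> (- ball 0 R0) = 0"
        using null by (simp add: measure_def)
      finally have "measure \<mu> (ball 0 r) \<le> measure \<mu> (ball 0 R0)"
        by simp
      moreover have "measure \<mu> (ball 0 R0) \<le> measure \<mu> (ball 0 r)"
        using 3 by (intro finite_measure_mono) (auto simp: sets)
      ultimately have "measure \<mu> (ball 0 r) = measure \<mu> (ball 0 R0)"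
        by (rule antisym)
      then show ?thesis using 3 \<open>R0 > 0\<close> by (simp add: full min_def)
    qed (use \<open>R0 > 0\<close> in \<open>auto simp: small min_def ball_empty\<close>)
  qed
  obtain K where "K \<ge> 0"
    "\<And>s \<delta>. \<delta> > 0 \<Longrightarrow> measure \<mu> {x. \<bar>norm x - s\<bar> < \<delta>} \<le> K * \<delta> powr min \<alpha> 1"
    using measure_annulus_le[OF fin sets \<open>\<alpha> > 0\<close> \<open>R0 > 0\<close> _ ball] \<open>c1 > 0\<close> by auto
  then have "(\<integral>\<^sup>+\<xi>. ennreal (inverse (1 + (norm \<xi>)\<^sup>2) * (norm (fourier_measure \<mu> \<xi>))\<^sup>2) \<partial>lborel) < \<infinity>"
    using \<open>\<alpha> > 0\<close> by (intro fourier_measure_weighted_L2[OF fin sets, of K "min \<alpha> 1"]) auto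
  then show ?thesis
    using tempered_distribution_measure_distr[OF fin sets] represented_by_fourier_measure[OF fin sets]
    unfolding H_minus1_def by blast
qed

end
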